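(* Let $d\ge1$ and $\boldsymbol{p}\in[0,1]^d$. Let $f^{\perp}\in\mathcal{B}_d(\boldsymbol{p})$ be the pmf of the Bernoulli random vector $\boldsymbol{I}^{\perp}$ with independent components, and let $f^H$ be the maximum entropy pmf of the class $\mathcal{B}_d^{\Sigma}(\boldsymbol{p})$. For $\alpha\in[0,1]$, let $\boldsymbol{I}^{(\alpha)}$ be a Bernoulli random vector with joint pmf $$f^{(\alpha)}(\boldsymbol{i})=(1-\alpha)f^H(\boldsymbol{i})+\alpha f^{\perp}(\boldsymbol{i}),\qquad \boldsymbol{i}\in\{0,1\}^d.$$ Then the class $\{f^{(\alpha)}:\alpha\in[0,1]\}$ is a chain in the partially ordered set $(\mathcal{B}_d(\boldsymbol{p}),\preceq_{sm})$. In particular, $f^{(\alpha)}$ satisfies the NSD property for every $\alpha\in[0,1]$, and for every $0\le\alpha_1\le\alpha_2\le1$, $$\boldsymbol{I}^H\preceq_{sm}\boldsymbol{I}^{(\alpha_1)}\preceq_{sm}\boldsymbol{I}^{(\alpha_2)}\preceq_{sm}\boldsymbol{I}^{\perp},$$ where $\boldsymbol{I}^H$ is a Bernoulli random vector with pmf $f^H$.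
   Context: $\mathcal{B}_d(\boldsymbol{p})$ is the class of probability mass functions (pmfs) on $\{0,1\}^d$ whose $j$-th one-dimensional marginal is Bernoulli with mean $p_j$, $j=1,\dots,d$; one also writes $\boldsymbol{I}\in\mathcal{B}_d(\boldsymbol{p})$ for a random vector with pmf in this class. Two real random variables $X,Y$ on a probability space $(\Omega,\mathcal{F},\mathbb{P})$ are countermonotonic if $(X(\omega)-X(\omega'))(Y(\omega)-Y(\omega'))\le 0$ for $(\mathbb{P}\times\mathbb{P})$-almost every $(\omega,\omega')\in\Omega^2$. A Bernoulli random vector $\boldsymbol{I}=(I_1,\dots,I_d)$ (or its pmf) is $\Sigma$-countermonotonic if for every $\Lambda\subseteq\{1,\dots,d\}$ the random variables $\sum_{j\in\Lambda}I_j$ and $\sum_{j\notin\Lambda}I_j$ are countermonotonic (with $\sum_{j\in\varnothing}I_j=0$). $\mathcal{B}_d^{\Sigma}(\boldsymbol{p})$ is the set of $\Sigma$-countermonotonic elements of $\mathcal{B}_d(\boldsymbol{p})$. Entropy: $H(f)=-\sum_{\boldsymbol{i}\in\{0,1\}^d}f(\boldsymbol{i})\ln f(\boldsymbol{i})$, with $0\ln0=0$; $f^H$ is the pmf maximizing $H$ over $\mathcal{B}_d^{\Sigma}(\boldsymbol{p})$. Supermodular order: $\phi:\{0,1\}^d\to\mathbb{R}$ is supermodular if $\phi(\boldsymbol{i})+\phi(\boldsymbol{k})\le\phi(\boldsymbol{i}\wedge\boldsymbol{k})+\phi(\boldsymbol{i}\vee\boldsymbol{k})$ for all $\boldsymbol{i},\boldsymbol{k}$,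 where $\wedge,\vee$ are componentwise minimum and maximum. For $\boldsymbol{I},\boldsymbol{K}\in\mathcal{B}_d(\boldsymbol{p})$, $\boldsymbol{I}\preceq_{sm}\boldsymbol{K}$ (equivalently, the same relation for their pmfs) means $E[\phi(\boldsymbol{I})]\le E[\phi(\boldsymbol{K})]$ for all supermodular $\phi$. $\boldsymbol{I}\in\mathcal{B}_d(\boldsymbol{p})$ (or its pmf) has the negative supermodular dependence (NSD) property if $\boldsymbol{I}\preceq_{sm}\boldsymbol{I}^{\perp}$, where $\boldsymbol{I}^{\perp}\in\mathcal{B}_d(\boldsymbol{p})$ has independent components. A chain in a partially ordered set is a subset in which any two elements are comparable. *)

theory Defs
  imports "HOL-Probability.Probability"
begin

text \<open>
  The index set \<open>{1,\<dots>,d}\<close> is a finite type \<^typ>\<open>'d\<close> (with \<open>d = CARD('d) \<ge> 1\<close>), and a point of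
  \<open>{0,1}\<^sup>d\<close> is a function \<^typ>\<open>'d \<Rightarrow> bool\<close>, with \<^const>\<open>True\<close> for 1. The
  library's lattice operations \<^const>\<open>inf\<close> and \<^const>\<open>sup\<close> on this type are then the
  componentwise minimum and maximum.
\<close>

definition bernoulli_class :: "('d::finite \<Rightarrow> real) \<Rightarrow> ('d \<Rightarrow> bool) pmf set" where
  "bernoulli_class p = {f. \<forall>j. map_pmf (\<lambda>i. i j) f = bernoulli_pmf (p j)}"

definition indep_bernoulli :: "('d::finite \<Rightarrow> real) \<Rightarrow> ('d \<Rightarrow> bool) pmf" where
  "indep_bernoulli p = Pi_pmf UNIV False (\<lambda>j. bernoulli_pmf (p j))"

definition countermonotonic :: "'a measure \<Rightarrow> ('a \<Rightarrow> real) \<Rightarrow> ('a \<Rightarrow> real) \<Rightarrow> bool" where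
  "countermonotonic M X Y \<longleftrightarrow>
     (AE (\<omega>, \<omega>') in M \<Otimes>\<^sub>M M. (X \<omega> - X \<omega>') * (Y \<omega> - Y \<omega>') \<le> 0)"

text \<open>
  The random vector with pmf \<open>f\<close> is the identity on the probability space
  \<^term>\<open>measure_pmf f\<close>.
\<close>

definition sigma_countermonotonic :: "('d::finite \<Rightarrow> bool) pmf \<Rightarrow> bool" where
  "sigma_countermonotonic f \<longleftrightarrow>
     (\<forall>\<Lambda>. countermonotonic (measure_pmf f)
            (\<lambda>i. \<Sum>j\<in>\<Lambda>. of_bool (i j)) (\<lambda>i. \<Sum>j\<in>-\<Lambda>. of_bool (i j)))"

definition sigma_countermonotonic_class :: "('d::finite \<Rightarrow> real) \<Rightarrow> ('d \<Rightarrow> bool) pmf set" where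
  "sigma_countermonotonic_class p = {f \<in> bernoulli_class p. sigma_countermonotonic f}"

text \<open>The convention \<open>0 ln 0 = 0\<close> needs no case distinction.\<close>

definition entropy_pmf :: "('d::finite \<Rightarrow> bool) pmf \<Rightarrow> real" where
  "entropy_pmf f = - (\<Sum>i\<in>UNIV. pmf f i * ln (pmf f i))"

definition max_entropy_pmf :: "('d::finite \<Rightarrow> real) \<Rightarrow> ('d \<Rightarrow> bool) pmf \<Rightarrow> bool" where
  "max_entropy_pmf p f \<longleftrightarrow>
     is_arg_max entropy_pmf (\<lambda>g. g \<in> sigma_countermonotonic_class p) f"

definition supermodular :: "(('d \<Rightarrow> bool) \<Rightarrow> real) \<Rightarrow> bool" where
  "supermodular \<phi> \<longleftrightarrow> (\<forall>i k. \<phi> i + \<phi> k \<le> \<phi> (inf i k) + \<phi> (sup i k))"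

definition sm_order :: "('d::finite \<Rightarrow> real) \<Rightarrow> ('d \<Rightarrow> bool) pmf rel" where
  "sm_order p = {(f, g). f \<in> bernoulli_class p \<and> g \<in> bernoulli_class p \<and>
     (\<forall>\<phi>. supermodular \<phi> \<longrightarrow> measure_pmf.expectation f \<phi> \<le> measure_pmf.expectation g \<phi>)}"

definition NSD :: "('d::finite \<Rightarrow> real) \<Rightarrow> ('d \<Rightarrow> bool) pmf \<Rightarrow> bool" where
  "NSD p f \<longleftrightarrow> (f, indep_bernoulli p) \<in> sm_order p"

definition mixture_pmf :: "real \<Rightarrow> 'a pmf \<Rightarrow> 'a pmf \<Rightarrow> 'a pmf" where
  "mixture_pmf \<alpha> f g = embed_pmf (\<lambda>i. (1 - \<alpha>) * pmf f i + \<alpha> * pmf g i)"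

lemma pmf_mixture_pmf:
  assumes "\<alpha> \<in> {0..1}"
  shows "pmf (mixture_pmf \<alpha> f g) i = (1 - \<alpha>) * pmf f i + \<alpha> * pmf g i"
  unfolding mixture_pmf_def
proof (rule pmf_embed_pmf)
  show "0 \<le> (1 - \<alpha>) * pmf f x + \<alpha> * pmf g x" for x
    using assms by simp
  have "(\<integral>\<^sup>+ x. ennreal ((1 - \<alpha>) * pmf f x + \<alpha> * pmf g x) \<partial>count_space UNIV) =
        (\<integral>\<^sup>+ x. ennreal (1 - \<alpha>) * ennreal (pmf f x) + ennreal \<alpha> * ennreal (pmf g x) \<partial>count_space UNIV)"
    using assms by (intro nn_integral_cong) (simp add: ennreal_plus ennreal_mult)
  also have "\<dots> = ennreal (1 - \<alpha>) * (\<integral>\<^sup>+ x. ennreal (pmf f x) \<partial>count_space UNIV) +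
                   ennreal \<alpha> * (\<integral>\<^sup>+ x. ennreal (pmf g x) \<partial>count_space UNIV)"
    by (simp add: nn_integral_add nn_integral_cmult)
  also have "\<dots> = 1"
    using assms by (simp add: nn_integral_pmf_eq_1 flip: ennreal_plus)
  finally show "(\<integral>\<^sup>+ x. ennreal ((1 - \<alpha>) * pmf f x + \<alpha> * pmf g x) \<partial>count_space UNIV) = 1" .
qed

lemma indep_bernoulli_in_bernoulli_class: "indep_bernoulli p \<in> bernoulli_class p"
  by (simp add: indep_bernoulli_def bernoulli_class_def Pi_pmf_component)

lemma partial_order_on_sm_order: "partial_order_on (bernoulli_class p) (sm_order p)"
proof -
  have "f = g" if fg: "(f, g) \<in> sm_order p" and gf: "(g, f) \<in> sm_order p" for f g
  proof (rule pmf_eqI)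
    fix i
    show "pmf f i = pmf g i"
    proof (induction "card {k. i < k}" arbitrary: i rule: less_induct)
      case less
      have IH: "pmf f k = pmf g k" if "i < k" for k
      proof (rule less)
        have "{l. k < l} \<subset> {l. i < l}"
          using that by (auto intro: less_trans)
        then show "card {l. k < l} < card {l. i < l}"
          by (intro psubset_card_mono) auto
      qed
      have "supermodular (\<lambda>k. of_bool (i \<le> k))"
        unfolding supermodular_def by (auto intro: le_supI1 le_supI2)
      then have "measure_pmf.expectation f (\<lambda>k. of_bool (i \<le> k) :: real) =
                 measure_pmf.expectation g (\<lambda>k. of_bool (i \<le> k))"
        using fg gf by (simp add: sm_order_def order_antisym)
      then have "(\<Sum>k\<in>UNIV. of_bool (i \<le> k) * pmf f k) = (\<Sum>k\<in>UNIV. of_bool (i \<le> k) * pmf g k)"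
        by (subst (asm) (1 2) integral_measure_pmf_real[where A = UNIV]) simp_all
      moreover have "(\<Sum>k\<in>UNIV. of_bool (i \<le> k) * pmf h k) = pmf h i + (\<Sum>k | i < k. pmf h k)" for h
      proof -
        have "(\<Sum>k\<in>UNIV. of_bool (i \<le> k) * pmf h k) = (\<Sum>k | i \<le> k. pmf h k)"
          by (rule sum.mono_neutral_cong_right) auto
        also have "{k. i \<le> k} = insert i {k. i < k}"
          by (auto simp: le_less)
        finally show ?thesis by simp
      qed
      moreover have "(\<Sum>k | i < k. pmf f k) = (\<Sum>k | i < k. pmf g k)"
        by (rule sum.cong) (auto simp: IH)
      ultimately show ?case by simp
    qed
  qed
  then show ?thesis
    by (auto simp: partial_order_on_def preorder_on_def sm_order_def
             intro!: refl_onI transI antisymI intro: order_trans)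
qed

end

theory Submission
  imports Defs
begin

text \<open>
  The heart of the matter is \<open>f\<^sup>H \<preceq>\<^sub>s\<^sub>m f\<^sup>\<bottom>\<close>. Once this is known, the expectation of a supermodular
  function under \<open>f\<^sup>(\<^sup>\<alpha>\<^sup>)\<close> is an affine function of \<open>\<alpha>\<close> that increases from its value under
  \<open>f\<^sup>H\<close> to its value under \<open>f\<^sup>\<bottom>\<close>, and everything else follows (\<open>sm_order_mixture_mono\<close>).

  A pmf is \<open>\<Sigma>\<close>-countermonotonic exactly if its support lies in two consecutive layers of the
  cube, that is, if the number of ones takes only the values \<open>k\<close> and \<open>k + 1\<close> for some \<open>k\<close>.
  Let \<open>u, v, w, z\<close> be points of these layers with the same coordinatewise sum \<open>u + v = w + z\<close>.
  Moving a small mass from \<open>{u, v}\<close> to \<open>{w, z}\<close> changes neither the marginals nor the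
  \<open>\<Sigma>\<close>-countermonotonicity, and it raises the entropy whenever \<open>f u * f v > f w * f z\<close>.
  The entropy maximizer therefore satisfies \<open>f u * f v = f w * f z\<close>
  (\<open>max_entropy_exchange_le\<close>).

  From the identities it follows that each coordinate \<open>I\<^sub>j\<close> is negatively correlated with every
  increasing function \<open>g\<close> of the others. Indeed, the covariance inequality says that the sum
  of \<open>f u * f v * (g v - g u)\<close> over \<open>u\<close> with \<open>u j = 1\<close> and \<open>v\<close> with \<open>v j = 0\<close> is
  nonnegative. For such a pair \<open>v\<close> has, off \<open>j\<close>, at least as many ones as \<open>u\<close>; handing the surplus
  over from \<open>v\<close> to \<open>u\<close> preserves \<open>u + v\<close>, hence the weight \<open>f u * f v\<close>, and an averaging
  over all the ways to do so pairs each term \<open>g u\<close> with a larger term \<open>g v'\<close>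
  (\<open>two_layer_exchange\<close>).

  Finally, the increment of a supermodular function in one coordinate is an increasing
  function of the others, so that replacing one coordinate by an independent copy can only
  increase the expectation (\<open>resample_coordinate\<close>). Replacing all coordinates one after the
  other leads to the independent vector (\<open>singleton_negatively_associated_NSD\<close>).
\<close>

section \<open>Exchanging elements between two consecutive layers\<close>

text \<open>
  Subsets of a finite set stand for points of the cube. For \<open>j \<in> A\<close>, \<open>j \<notin> B\<close> let
  \<open>t = |B| - |A - {j}| \<ge> 0\<close>, and let \<open>T\<close> range over the \<open>t\<close>-subsets of \<open>B - A\<close>. The map
  \<open>(A, B, T) \<mapsto> ({j} \<union> (B - T), (A - {j}) \<union> T, T)\<close> is an involution which preserves \<open>A \<inter> B\<close>,
  \<open>A \<union> B\<close>, \<open>|A|\<close> and \<open>|B|\<close>, hence also \<open>F A * F B\<close> and the number of choices of \<open>T\<close>. It turns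
  the second set into a superset of \<open>A - {j}\<close>, where \<open>g\<close> is at least \<open>g A\<close>.
\<close>

lemma two_layer_exchange:
  fixes F g :: "'d::finite set \<Rightarrow> real"
  assumes nonneg: "\<And>A. 0 \<le> F A"
    and supp: "\<And>A. F A \<noteq> 0 \<Longrightarrow> card A \<in> {k, Suc k}"
    and quad: "\<And>A B A' B'. card A \<in> {k, Suc k} \<Longrightarrow> card B \<in> {k, Suc k} \<Longrightarrow>
       card A' \<in> {k, Suc k} \<Longrightarrow> card B' \<in> {k, Suc k} \<Longrightarrow>
       A \<inter> B = A' \<inter> B' \<Longrightarrow> A \<union> B = A' \<union> B' \<Longrightarrow> F A * F B = F A' * F B'"
    and mono: "\<And>A B. A - {j} \<subseteq> B \<Longrightarrow> g A \<le> g B"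
  shows "(\<Sum>A | j \<in> A. \<Sum>B | j \<notin> B. F A * F B * g A) \<le> (\<Sum>A | j \<in> A. \<Sum>B | j \<notin> B. F A * F B * g B)"
proof -
  define P :: "('d set \<times> 'd set) set" where "P = {(A, B). j \<in> A \<and> j \<notin> B \<and> card A \<in> {k, Suc k} \<and> card B \<in> {k, Suc k}}"
  define S :: "'d set \<times> 'd set \<Rightarrow> 'd set set" where "S = (\<lambda>(A, B). {T. T \<subseteq> B - A \<and> card T = Suc (card B) - card A})"
  \<comment> \<open>The weight of a pair is distributed equally among its transfer sets \<open>T\<close>.\<close>
  define W where "W = (\<lambda>(A, B). F A * F B / card (S (A, B)))"
  define \<Phi> where "\<Phi> = (\<lambda>((A, B), T). ((insert j (B - T), (A - {j}) \<union> T), T))"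
  have restrict: "(\<Sum>A | j \<in> A. \<Sum>B | j \<notin> B. F A * F B * h A B) = (\<Sum>(A, B)\<in>P. F A * F B * h A B)"
    for h :: "'d set \<Rightarrow> 'd set \<Rightarrow> real"
  proof -
    have "(\<Sum>A | j \<in> A. \<Sum>B | j \<notin> B. F A * F B * h A B) =
      (\<Sum>(A, B)\<in>{A. j \<in> A} \<times> {B. j \<notin> B}. F A * F B * h A B)"
      by (rule sum.cartesian_product)
    also have "\<dots> = (\<Sum>(A, B)\<in>P. F A * F B * h A B)"
      by (rule sum.mono_neutral_right) (auto simp: P_def dest: supp)
    finally show ?thesis .
  qed
  have card_S: "card (S (A, B)) = card (B - A) choose (Suc (card B) - card A)" for A B
    unfolding S_def by (simp add: n_subsets)
  have card_Diff: "card (B - A) = card B - card (A \<inter> B)" for A B :: "'d set"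
    by (simp add: card_Diff_subset_Int Int_commute)
  \<comment> \<open>Since \<open>j \<in> A - B\<close>, the surplus of \<open>B\<close> over \<open>A - {j}\<close> is at most \<open>|B - A|\<close>.\<close>
  have S_pos: "card (S (A, B)) > 0" if "(A, B) \<in> P" for A B
  proof -
    have "A \<inter> B \<subseteq> A - {j}" "j \<in> A" using that by (auto simp: P_def)
    then have "card (A \<inter> B) < card A"
      by (intro psubset_card_mono) auto
    then show ?thesis
      unfolding card_S card_Diff by (simp add: zero_less_binomial_iff)
  qed
  have spread: "(\<Sum>(A, B)\<in>P. F A * F B * h A B) = (\<Sum>((A, B), T)\<in>Sigma P S. W (A, B) * h A B)"
    for h :: "'d set \<Rightarrow> 'd set \<Rightarrow> real"
  proof -
    have "(\<Sum>((A, B), T)\<in>Sigma P S. W (A, B) * h A B) =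
        (\<Sum>x\<in>P. \<Sum>T\<in>S x. case x of (A, B) \<Rightarrow> W (A, B) * h A B)"
      by (subst sum.Sigma) (auto simp: split_beta)
    also have "\<dots> = (\<Sum>(A, B)\<in>P. F A * F B * h A B)"
    proof (rule sum.cong[OF refl], clarify)
      fix A B assume "(A, B) \<in> P"
      from S_pos[OF this] show "(\<Sum>T\<in>S (A, B). W (A, B) * h A B) = F A * F B * h A B"
        by (auto simp: W_def)
    qed
    finally show ?thesis by simp
  qed
  have props: "\<Phi> x \<in> Sigma P S \<and> \<Phi> (\<Phi> x) = x \<and> W (fst (\<Phi> x)) = W (fst x)
      \<and> g (fst (fst x)) \<le> g (snd (fst (\<Phi> x)))"
    if x: "x \<in> Sigma P S" for x
  proof -
    obtain A B T where xe: "x = ((A, B), T)" by (metis prod.exhaust)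
    from x have j: "j \<in> A" "j \<notin> B" and cA: "card A \<in> {k, Suc k}" and cB: "card B \<in> {k, Suc k}"
      and T: "T \<subseteq> B - A" "card T = Suc (card B) - card A"
      by (auto simp: xe P_def S_def)
    define A' B' where "A' = insert j (B - T)" and "B' = (A - {j}) \<union> T"
    have "card T \<le> card B" using T(1) by (intro card_mono) auto
    have "T \<subseteq> B" using T by auto
    have "card A' = Suc (card B - card T)"
      unfolding A'_def using j by (simp add: card_Diff_subset[OF _ \<open>T \<subseteq> B\<close>])
    then have cA': "card A' = card A"
      using \<open>card T \<le> card B\<close> T(2) cA cB by auto
    have "0 < card A" using j(1) by (auto simp: card_gt_0_iff)
    have "card B' = card (A - {j}) + card T"
      unfolding B'_def using T by (intro card_Un_disjoint) auto
    then have cB': "card B' = card B"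
      using j(1) T(2) cA cB \<open>0 < card A\<close> by auto
    have I: "A' \<inter> B' = A \<inter> B" and U: "A' \<union> B' = A \<union> B"
      using j T by (auto simp: A'_def B'_def)
    have \<Phi>x: "\<Phi> x = ((A', B'), T)" by (simp add: xe \<Phi>_def A'_def B'_def)
    have "F A' * F B' = F A * F B"
      by (rule quad) (use cA cB cA' cB' I U in auto)
    then have "W (A', B') = W (A, B)"
      by (simp add: W_def card_S card_Diff cA' cB' I)
    moreover have "\<Phi> x \<in> Sigma P S"
    proof -
      have "(A', B') \<in> P"
        unfolding P_def using cA cB cA' cB' j by (simp add: A'_def B'_def) (use T in blast)
      moreover have "T \<in> S (A', B')"
        unfolding S_def using T(2) cA' cB' by (simp add: A'_def B'_def) (use T j in blast)
      ultimately show ?thesis by (simp add: \<Phi>x)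
    qed
    moreover have "\<Phi> (\<Phi> x) = x"
    proof -
      have "insert j (B' - T) = A" "(A' - {j}) \<union> T = B"
        using j T(1) by (auto simp: A'_def B'_def)
      then show ?thesis unfolding \<Phi>x by (simp add: \<Phi>_def xe)
    qed
    moreover have "g A \<le> g B'" by (rule mono) (auto simp: B'_def)
    ultimately show ?thesis by (simp only: \<Phi>x fst_conv snd_conv) (simp add: xe)
  qed
  have bij: "bij_betw \<Phi> (Sigma P S) (Sigma P S)"
    by (rule bij_betw_byWitness[where f' = \<Phi>]) (use props in blast)+
  have W_nonneg: "0 \<le> W x" for x
    by (auto simp: W_def nonneg split: prod.split)
  have "(\<Sum>A | j \<in> A. \<Sum>B | j \<notin> B. F A * F B * g A) = (\<Sum>x\<in>Sigma P S. W (fst x) * g (fst (fst x)))"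
    using restrict[of "\<lambda>A B. g A"] spread[of "\<lambda>A B. g A"] by (simp add: split_beta)
  also have "\<dots> \<le> (\<Sum>x\<in>Sigma P S. W (fst (\<Phi> x)) * g (snd (fst (\<Phi> x))))"
  proof (rule sum_mono)
    fix x assume "x \<in> Sigma P S"
    from props[OF this] show "W (fst x) * g (fst (fst x)) \<le> W (fst (\<Phi> x)) * g (snd (fst (\<Phi> x)))"
      by (simp add: mult_left_mono W_nonneg)
  qed
  also have "\<dots> = (\<Sum>x\<in>Sigma P S. W (fst x) * g (snd (fst x)))"
    by (rule sum.reindex_bij_betw[OF bij])
  also have "\<dots> = (\<Sum>A | j \<in> A. \<Sum>B | j \<notin> B. F A * F B * g B)"
    using restrict[of "\<lambda>A B. g B"] spread[of "\<lambda>A B. g B"] by (simp add: split_beta)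
  finally show ?thesis .
qed

section \<open>Marginals and Sigma-countermonotonicity on the cube\<close>

lemma bernoulli_class_iff:
  fixes p :: "'d::finite \<Rightarrow> real"
  assumes "\<And>j. p j \<in> {0..1}"
  shows "f \<in> bernoulli_class p \<longleftrightarrow> (\<forall>j. (\<Sum>i | i j. pmf f i) = p j)"
proof -
  have "pmf (map_pmf (\<lambda>i. i j) f) True = (\<Sum>i | i j. pmf f i)" for j
  proof -
    have "(\<lambda>i. i j) -` {True} = {i. i j}" by auto
    then show ?thesis by (simp add: pmf_map measure_measure_pmf_finite)
  qed
  moreover have "q = bernoulli_pmf t \<longleftrightarrow> pmf q True = t" if "t \<in> {0..1}" for q t
    using that pmf_False_conv_True[of q] by (auto simp: pmf_eq_iff all_bool_eq)
  ultimately show ?thesis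
    using assms by (simp add: bernoulli_class_def)
qed

lemma countermonotonic_pmf_iff:
  fixes f :: "'a::finite pmf"
  shows "countermonotonic (measure_pmf f) X Y \<longleftrightarrow>
    (\<forall>u\<in>set_pmf f. \<forall>v\<in>set_pmf f. (X u - X v) * (Y u - Y v) \<le> 0)"
proof -
  interpret pair_sigma_finite "measure_pmf f" "measure_pmf f" ..
  have "sets (measure_pmf f \<Otimes>\<^sub>M measure_pmf f) = Pow (UNIV \<times> UNIV)"
    by (rule sets_pair_countable) auto
  then show ?thesis
    unfolding countermonotonic_def
    using AE_pair_iff[of "\<lambda>u v. (X u - X v) * (Y u - Y v) \<le> 0"]
    by (simp add: split_beta AE_measure_pmf_iff)
qed

text \<open>
  For two points of consecutive layers, the increments of the two partial sums are integers
  whose sum lies in \<open>{-1, 0, 1}\<close>; two such integers cannot have the same strict sign.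
\<close>

lemma sigma_countermonotonic_if_two_layers:
  fixes f :: "('d::finite \<Rightarrow> bool) pmf"
  assumes "\<And>i. i \<in> set_pmf f \<Longrightarrow> card {l. i l} \<in> {k, Suc k}"
  shows "sigma_countermonotonic f"
  unfolding sigma_countermonotonic_def countermonotonic_pmf_iff
proof (intro allI ballI)
  fix \<Lambda> and u v assume uv: "u \<in> set_pmf f" "v \<in> set_pmf f"
  define D :: "'d set \<Rightarrow> int" where "D \<Lambda> = (\<Sum>j\<in>\<Lambda>. of_bool (u j) - of_bool (v j))" for \<Lambda>
  have R: "(\<Sum>j\<in>\<Lambda>. of_bool (u j)) - (\<Sum>j\<in>\<Lambda>. of_bool (v j)) = real_of_int (D \<Lambda>)" for \<Lambda>
    by (simp add: D_def sum_subtractf)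
  have "D \<Lambda> + D (- \<Lambda>) = D UNIV"
    unfolding D_def by (subst sum.union_disjoint[symmetric]) auto
  also have "\<dots> = int (card {l. u l}) - int (card {l. v l})"
    by (simp add: D_def sum_subtractf sum_of_bool_eq)
  finally have "D \<Lambda> + D (- \<Lambda>) \<in> {-1, 0, 1}"
    using assms[OF uv(1)] assms[OF uv(2)] by auto
  then have "(D \<Lambda> \<le> 0 \<and> 0 \<le> D (- \<Lambda>)) \<or> (0 \<le> D \<Lambda> \<and> D (- \<Lambda>) \<le> 0)"
    by auto
  then have "D \<Lambda> * D (- \<Lambda>) \<le> 0" by (auto simp: mult_le_0_iff)
  then show "((\<Sum>j\<in>\<Lambda>. of_bool (u j)) - (\<Sum>j\<in>\<Lambda>. of_bool (v j))) *
      ((\<Sum>j\<in>-\<Lambda>. of_bool (u j)) - (\<Sum>j\<in>-\<Lambda>. of_bool (v j))) \<le> (0::real)"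
    unfolding R by (simp flip: of_int_mult)
qed

text \<open>
  If \<open>u\<close> has at least two more ones than \<open>v\<close>, then a singleton \<open>\<Lambda> = {x}\<close> with \<open>u x = 1\<close> and
  \<open>v x = 0\<close> violates countermonotonicity: the remaining coordinates still have a surplus.
\<close>

lemma sigma_countermonotonic_two_layers:
  fixes f :: "('d::finite \<Rightarrow> bool) pmf"
  assumes "sigma_countermonotonic f"
  obtains k where "\<And>i. i \<in> set_pmf f \<Longrightarrow> card {l. i l} \<in> {k, Suc k}"
proof -
  have close: "card {l. u l} \<le> Suc (card {l. v l})" if uv: "u \<in> set_pmf f" "v \<in> set_pmf f" for u v
  proof (rule ccontr)
    assume "\<not> ?thesis"
    then have gt: "card {l. v l} + 2 \<le> card {l. u l}" by simp
    have "\<not> {l. u l} \<subseteq> {l. v l}"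
      using gt card_mono[of "{l. v l}" "{l. u l}"] by auto
    then obtain x where x: "u x" "\<not> v x" by auto
    have split: "(\<Sum>j\<in>-{x}. of_bool (i j)) = real (card {l. i l}) - of_bool (i x)"
      for i :: "'d \<Rightarrow> bool"
      using sum.remove[of UNIV x "\<lambda>j. of_bool (i j) :: real"]
      by (simp add: sum_of_bool_eq Compl_eq_Diff_UNIV)
    from assms uv have
      "((\<Sum>j\<in>{x}. of_bool (u j)) - (\<Sum>j\<in>{x}. of_bool (v j))) *
       ((\<Sum>j\<in>-{x}. of_bool (u j)) - (\<Sum>j\<in>-{x}. of_bool (v j))) \<le> (0::real)"
      unfolding sigma_countermonotonic_def countermonotonic_pmf_iff by blast
    then show False using x gt by (simp add: split)
  qed
  define k where "k = Min ((\<lambda>i. card {l. i l}) ` set_pmf f)"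
  have "k \<in> (\<lambda>i. card {l. i l}) ` set_pmf f"
    unfolding k_def by (rule Min_in) (auto simp: set_pmf_not_empty)
  then obtain v where v: "v \<in> set_pmf f" "k = card {l. v l}" by auto
  have "card {l. i l} \<in> {k, Suc k}" if "i \<in> set_pmf f" for i
  proof -
    have "k \<le> card {l. i l}" unfolding k_def using that by simp
    with close[OF that v(1)] v(2) show ?thesis by auto
  qed
  then show thesis by (rule that)
qed

section \<open>The entropy maximizer satisfies quadratic identities\<close>

text \<open>The graph of \<open>y ln y\<close> lies above its tangents; the point \<open>y = 0\<close> is included.\<close>

lemma x_ln_x_tangent:
  fixes x y :: real
  assumes "0 < x" "0 \<le> y"
  shows "y * ln x + (y - x) \<le> y * ln y"
proof (cases "y = 0")
  case False
  with assms have "y > 0" by simp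
  then have "ln (x / y) \<le> x / y - 1" using assms by (intro ln_le_minus_one) simp
  then have "y * ln (x / y) \<le> y * (x / y - 1)" using \<open>y > 0\<close> by (intro mult_left_mono) auto
  then show ?thesis using assms \<open>y > 0\<close> by (simp add: ln_div algebra_simps)
qed (use assms in auto)

text \<open>
  Taking the tangents at the perturbed arguments, which are all positive, avoids the infinite
  slope of \<open>x ln x\<close> at those of the original arguments that vanish.
\<close>

lemma entropy_exchange:
  fixes a b c d e :: real
  assumes "0 \<le> c" "0 \<le> d" "0 < e" "e < a" "e < b"
    and prod: "(c + e) * (d + e) < (a - e) * (b - e)"
  shows "(a - e) * ln (a - e) + (b - e) * ln (b - e) + (c + e) * ln (c + e) + (d + e) * ln (d + e)
    < a * ln a + b * ln b + c * ln c + d * ln d"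
proof -
  have "ln ((c + e) * (d + e)) < ln ((a - e) * (b - e))"
    using assms by simp
  then have "ln (c + e) + ln (d + e) < ln (a - e) + ln (b - e)"
    using assms by (simp add: ln_mult)
  then have "e * (ln (c + e) + ln (d + e)) < e * (ln (a - e) + ln (b - e))"
    using \<open>0 < e\<close> by simp
  moreover have "a * ln (a - e) + (a - (a - e)) \<le> a * ln a" "b * ln (b - e) + (b - (b - e)) \<le> b * ln b"
    "c * ln (c + e) + (c - (c + e)) \<le> c * ln c" "d * ln (d + e) + (d - (d + e)) \<le> d * ln d"
    by (rule x_ln_x_tangent; use assms in simp)+
  ultimately show ?thesis by (simp add: algebra_simps)
qed


text \<open>
  If \<open>f u * f v > f w * f z\<close>, moving mass \<open>e\<close> from \<open>u\<close> and \<open>v\<close> to \<open>w\<close> and \<open>z\<close> keeps the marginals,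
  because \<open>u + v = w + z\<close>, and keeps the support in the two layers, but raises the entropy.
\<close>

lemma max_entropy_exchange_le:
  fixes p :: "'d::finite \<Rightarrow> real"
  assumes p: "\<And>j. p j \<in> {0..1}" and max: "max_entropy_pmf p f"
    and layers: "\<And>i. i \<in> set_pmf f \<Longrightarrow> card {l. i l} \<in> {k, Suc k}"
    and uvwz: "\<And>i. i \<in> {u, v, w, z} \<Longrightarrow> card {l. i l} \<in> {k, Suc k}"
    and inf: "inf u v = inf w z" and sup: "sup u v = sup w z"
  shows "pmf f u * pmf f v \<le> pmf f w * pmf f z"
proof (rule ccontr)
  assume "\<not> ?thesis"
  then have gt: "pmf f w * pmf f z < pmf f u * pmf f v" by simp
  have coord: "(u l \<and> v l \<longleftrightarrow> w l \<and> z l) \<and> (u l \<or> v l \<longleftrightarrow> w l \<or> z l)" for l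
    using fun_cong[OF inf, of l] fun_cong[OF sup, of l] by simp
  \<comment> \<open>If the inequality fails, the four points are distinct: the meet and the join of two points
      together with one of the points determine the other one.\<close>
  have swap: "i = i' \<longleftrightarrow> m = m'"
    if "\<And>l. (i l \<and> m l \<longleftrightarrow> i' l \<and> m' l) \<and> (i l \<or> m l \<longleftrightarrow> i' l \<or> m' l)" for i m i' m' :: "'d \<Rightarrow> bool"
    unfolding fun_eq_iff using that by blast
  have "\<not> (u = w \<and> v = z)" "\<not> (u = z \<and> v = w)" using gt by (auto simp: mult.commute)
  moreover have "u = w \<longleftrightarrow> v = z" by (rule swap) (rule coord)
  moreover have "u = z \<longleftrightarrow> v = w" by (rule swap) (use coord in blast)
  moreover have "u = w \<and> v = z" if "u = v"
  proof -
    have "u l = w l \<and> v l = z l" for l using coord[of l] that by auto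
    then show ?thesis by auto
  qed
  moreover have "u = w \<and> v = z" if "w = z"
  proof -
    have "u l = w l \<and> v l = z l" for l using coord[of l] that by auto
    then show ?thesis by auto
  qed
  ultimately have dist: "u \<noteq> v" "u \<noteq> w" "u \<noteq> z" "v \<noteq> w" "v \<noteq> z" "w \<noteq> z"
    by metis+
  \<comment> \<open>The quadratic terms cancel in \<open>(f u - e) * (f v - e) - (f w + e) * (f z + e)\<close>, which equals
      \<open>f u * f v - f w * f z - e * s\<close>. The choice of \<open>e\<close> halves the original difference.\<close>
  define s where "s = pmf f u + pmf f v + pmf f w + pmf f z"
  define e where "e = (pmf f u * pmf f v - pmf f w * pmf f z) / (2 * s)"
  have "0 < pmf f u * pmf f v" using gt by (smt (verit) mult_nonneg_nonneg pmf_nonneg)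
  then have pos: "0 < pmf f u" "0 < pmf f v"
    by (auto simp: zero_less_mult_iff order_less_le)
  then have "0 < s" by (simp add: s_def add_pos_pos add_pos_nonneg)
  then have es: "2 * (e * s) = pmf f u * pmf f v - pmf f w * pmf f z" and e: "0 < e"
    using gt by (simp_all add: e_def)
  have less: "e < x" if "x * y = pmf f u * pmf f v" "x + y \<le> s" "0 < x" "0 < y" for x y
  proof (rule ccontr)
    assume "\<not> e < x"
    then have "x * (x + y) \<le> e * s" using that e by (intro mult_mono) auto
    moreover have "0 \<le> pmf f w * pmf f z" "0 < x * x" "0 < x * y" using that(3,4) by auto
    ultimately show False using es that(1) by (simp add: algebra_simps)
  qed
  have eu: "e < pmf f u" by (rule less[of _ "pmf f v"]) (use pos in \<open>auto simp: s_def\<close>)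
  have ev: "e < pmf f v" by (rule less[of _ "pmf f u"]) (use pos in \<open>auto simp: s_def mult.commute\<close>)
  define g where "g i = pmf f i - e * (of_bool (i = u) + of_bool (i = v))
      + e * (of_bool (i = w) + of_bool (i = z))" for i
  have g_nonneg: "0 \<le> g i" for i
    using e eu ev dist by (auto simp: g_def)
  have sum_g: "(\<Sum>i\<in>A. g i) = (\<Sum>i\<in>A. pmf f i) - e * (of_bool (u \<in> A) + of_bool (v \<in> A))
      + e * (of_bool (w \<in> A) + of_bool (z \<in> A))" for A
  proof -
    have "(\<Sum>i\<in>A. of_bool (i = x)) = (of_bool (x \<in> A) :: real)" for x
      by (simp add: of_bool_def sum.delta)
    then show ?thesis
      unfolding g_def by (simp add: sum.distrib sum_subtractf flip: sum_distrib_left)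
  qed
  define G where "G = embed_pmf g"
  have G: "pmf G i = g i" for i
    unfolding G_def
  proof (rule pmf_embed_pmf[OF g_nonneg])
    have "(\<Sum>i\<in>UNIV. g i) = 1" by (simp add: sum_g sum_pmf_eq_1)
    then show "(\<integral>\<^sup>+ x. ennreal (g x) \<partial>count_space UNIV) = 1"
      by (simp add: nn_integral_count_space_finite g_nonneg sum_ennreal)
  qed
  have "f \<in> bernoulli_class p"
    using max by (simp add: max_entropy_pmf_def is_arg_max_def sigma_countermonotonic_class_def)
  then have "(\<Sum>i | i j. pmf f i) = p j" for j
    by (simp add: bernoulli_class_iff[OF p])
  moreover have "of_bool (u j) + of_bool (v j) = (of_bool (w j) + of_bool (z j) :: real)" for j
    using coord[of j] by auto
  ultimately have "G \<in> bernoulli_class p"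
    unfolding bernoulli_class_iff[OF p] by (simp add: G sum_g)
  moreover have "sigma_countermonotonic G"
  proof (rule sigma_countermonotonic_if_two_layers)
    fix i assume "i \<in> set_pmf G"
    then have "g i \<noteq> 0" by (simp add: set_pmf_iff G)
    then have "i \<in> set_pmf f \<or> i \<in> {u, v, w, z}"
      by (auto simp: g_def set_pmf_iff split: if_splits)
    then show "card {l. i l} \<in> {k, Suc k}" using layers uvwz by blast
  qed
  ultimately have "G \<in> sigma_countermonotonic_class p"
    by (simp add: sigma_countermonotonic_class_def)
  then have "entropy_pmf G \<le> entropy_pmf f"
    using max by (auto simp: max_entropy_pmf_def is_arg_max_def not_less)
  moreover have "(\<Sum>i\<in>UNIV. g i * ln (g i)) < (\<Sum>i\<in>UNIV. pmf f i * ln (pmf f i))"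
  proof -
    let ?X = "{u, v, w, z}"
    have split: "(\<Sum>i\<in>UNIV. h i) = (\<Sum>i\<in>- ?X. h i) + (h u + h v + h w + h z)"
      for h :: "('d \<Rightarrow> bool) \<Rightarrow> real"
    proof -
      have "(\<Sum>i\<in>UNIV. h i) = (\<Sum>i\<in>- ?X. h i) + (\<Sum>i\<in>?X. h i)"
        using sum.subset_diff[of ?X UNIV h] by (simp add: Compl_eq_Diff_UNIV)
      then show ?thesis using dist by simp
    qed
    have out: "(\<Sum>i\<in>- ?X. g i * ln (g i)) = (\<Sum>i\<in>- ?X. pmf f i * ln (pmf f i))"
      by (rule sum.cong) (auto simp: g_def)
    have at: "g u = pmf f u - e" "g v = pmf f v - e" "g w = pmf f w + e" "g z = pmf f z + e"
      using dist by (auto simp: g_def)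
    have "(pmf f w + e) * (pmf f z + e) < (pmf f u - e) * (pmf f v - e)"
      using es gt by (simp add: s_def algebra_simps)
    from entropy_exchange[OF pmf_nonneg pmf_nonneg e eu ev this] show ?thesis
      unfolding split out at by simp
  qed
  ultimately show False by (simp add: entropy_pmf_def G)
qed

section \<open>Negative association of single coordinates\<close>

text \<open>
  Negative association in which one of the two groups of coordinates is a singleton: \<open>I\<^sub>j\<close> is
  negatively correlated with every increasing function of the other coordinates. The
  condition on \<open>g\<close> expresses both that \<open>g\<close> does not depend on coordinate \<open>j\<close> and that it is
  increasing.
\<close>

definition singleton_negatively_associated :: "('d::finite \<Rightarrow> bool) pmf \<Rightarrow> bool" where
  "singleton_negatively_associated f \<longleftrightarrow>
     (\<forall>j g. (\<forall>u v. (\<forall>l. l \<noteq> j \<longrightarrow> u l \<longrightarrow> v l) \<longrightarrow> g u \<le> (g v :: real)) \<longrightarrow>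
        (\<Sum>i | i j. pmf f i * g i) \<le> (\<Sum>i | i j. pmf f i) * (\<Sum>i\<in>UNIV. pmf f i * g i))"

text \<open>
  With \<open>P = \<P>(I\<^sub>j = 1)\<close>, the claim \<open>E[I\<^sub>j g] \<le> P * E[g]\<close> is the same as
  \<open>E[I\<^sub>j g] * (1 - P) \<le> P * E[(1 - I\<^sub>j) g]\<close>, and both sides of the latter are the double sums
  compared by the exchange argument.
\<close>

lemma singleton_negatively_associated_two_layers:
  fixes f :: "('d::finite \<Rightarrow> bool) pmf"
  assumes layers: "\<And>i. i \<in> set_pmf f \<Longrightarrow> card {l. i l} \<in> {k, Suc k}"
    and quad: "\<And>u v w z. (\<And>i. i \<in> {u, v, w, z} \<Longrightarrow> card {l. i l} \<in> {k, Suc k}) \<Longrightarrow>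
       inf u v = inf w z \<Longrightarrow> sup u v = sup w z \<Longrightarrow> pmf f u * pmf f v = pmf f w * pmf f z"
  shows "singleton_negatively_associated f"
  unfolding singleton_negatively_associated_def
proof (intro allI impI)
  fix j and g :: "('d \<Rightarrow> bool) \<Rightarrow> real"
  assume mono: "\<forall>u v. (\<forall>l. l \<noteq> j \<longrightarrow> u l \<longrightarrow> v l) \<longrightarrow> g u \<le> g v"
  define F where "F A = pmf f (\<lambda>l. l \<in> A)" for A
  have "(\<Sum>A | j \<in> A. \<Sum>B | j \<notin> B. F A * F B * g (\<lambda>l. l \<in> A)) \<le>
        (\<Sum>A | j \<in> A. \<Sum>B | j \<notin> B. F A * F B * g (\<lambda>l. l \<in> B))"
  proof (rule two_layer_exchange[where k = k])
    show "0 \<le> F A" for A by (simp add: F_def)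
    show "card A \<in> {k, Suc k}" if "F A \<noteq> 0" for A
      using layers[of "\<lambda>l. l \<in> A"] that by (simp add: F_def set_pmf_iff)
    show "F A * F B = F A' * F B'" if "card A \<in> {k, Suc k}" "card B \<in> {k, Suc k}"
      "card A' \<in> {k, Suc k}" "card B' \<in> {k, Suc k}" "A \<inter> B = A' \<inter> B'" "A \<union> B = A' \<union> B'"
      for A B A' B'
      unfolding F_def
    proof (rule quad)
      show "card {l. i l} \<in> {k, Suc k}"
        if "i \<in> {\<lambda>l. l \<in> A, \<lambda>l. l \<in> B, \<lambda>l. l \<in> A', \<lambda>l. l \<in> B'}" for i
        using that \<open>card A \<in> _\<close> \<open>card B \<in> _\<close> \<open>card A' \<in> _\<close> \<open>card B' \<in> _\<close> by auto
    qed (use that(5,6) in \<open>auto simp: fun_eq_iff set_eq_iff\<close>)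
    show "g (\<lambda>l. l \<in> A) \<le> g (\<lambda>l. l \<in> B)" if "A - {j} \<subseteq> B" for A B
      by (rule mono[rule_format]) (use that in auto)
  qed
  also have "(\<Sum>A | j \<in> A. \<Sum>B | j \<notin> B. F A * F B * g (\<lambda>l. l \<in> A)) =
      (\<Sum>A | j \<in> A. F A * g (\<lambda>l. l \<in> A)) * (\<Sum>B | j \<notin> B. F B)"
    unfolding sum_product by (intro sum.cong) (simp_all add: mult_ac)
  also have "(\<Sum>A | j \<in> A. \<Sum>B | j \<notin> B. F A * F B * g (\<lambda>l. l \<in> B)) =
      (\<Sum>A | j \<in> A. F A) * (\<Sum>B | j \<notin> B. F B * g (\<lambda>l. l \<in> B))"
    unfolding sum_product by (intro sum.cong) (simp_all add: mult_ac)
  finally have le: "(\<Sum>A | j \<in> A. F A * g (\<lambda>l. l \<in> A)) * (\<Sum>B | j \<notin> B. F B) \<le>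
      (\<Sum>A | j \<in> A. F A) * (\<Sum>B | j \<notin> B. F B * g (\<lambda>l. l \<in> B))" .
  have reindex: "(\<Sum>A | j \<in> A. h (\<lambda>l. l \<in> A)) = (\<Sum>i | i j. h i)"
    "(\<Sum>A | j \<notin> A. h (\<lambda>l. l \<in> A)) = (\<Sum>i | \<not> i j. h i)" for h :: "('d \<Rightarrow> bool) \<Rightarrow> real"
    by (rule sum.reindex_bij_witness[of _ Collect "\<lambda>A l. l \<in> A"]; simp)+
  have compl: "(\<Sum>i | \<not> i j. h i) = (\<Sum>i\<in>UNIV. h i) - (\<Sum>i | i j. h i)" for h :: "('d \<Rightarrow> bool) \<Rightarrow> real"
  proof -
    have "(\<Sum>i\<in>UNIV. h i) = (\<Sum>i | i j. h i) + (\<Sum>i | \<not> i j. h i)"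
      using sum.subset_diff[of "{i. i j}" UNIV h] by (simp add: Collect_neg_eq Compl_eq_Diff_UNIV)
    then show ?thesis by simp
  qed
  from le have "(\<Sum>i | i j. pmf f i * g i) * (1 - (\<Sum>i | i j. pmf f i)) \<le>
      (\<Sum>i | i j. pmf f i) * ((\<Sum>i\<in>UNIV. pmf f i * g i) - (\<Sum>i | i j. pmf f i * g i))"
    unfolding F_def reindex[of "pmf f"] reindex[of "\<lambda>i. pmf f i * g i"] compl
    by (simp add: sum_pmf_eq_1)
  then show "(\<Sum>i | i j. pmf f i * g i) \<le> (\<Sum>i | i j. pmf f i) * (\<Sum>i\<in>UNIV. pmf f i * g i)"
    by (simp add: algebra_simps)
qed

section \<open>From negative association to the supermodular order\<close>

lemma expectation_sum:
  fixes f :: "'a::finite pmf" and \<phi> :: "'a \<Rightarrow> real"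
  shows "measure_pmf.expectation f \<phi> = (\<Sum>i\<in>UNIV. pmf f i * \<phi> i)"
  by (subst integral_measure_pmf_real[of UNIV]) (auto simp: mult.commute)

lemma supermodular_increment_mono:
  assumes "supermodular \<phi>" and "\<forall>l. l \<noteq> j \<longrightarrow> u l \<longrightarrow> v l"
  shows "\<phi> (u(j := True)) - \<phi> (u(j := False)) \<le> \<phi> (v(j := True)) - \<phi> (v(j := False))"
proof -
  have "inf (u(j := True)) (v(j := False)) = u(j := False)"
    "sup (u(j := True)) (v(j := False)) = v(j := True)"
    using assms(2) by (auto simp: fun_eq_iff)
  then show ?thesis
    using assms(1)[unfolded supermodular_def, rule_format, of "u(j := True)" "v(j := False)"] by simp
qed

lemma supermodular_override_on:
  assumes "supermodular \<phi>"
  shows "supermodular (\<lambda>i. \<phi> (override_on i b A))"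
proof -
  have "inf (override_on i b A) (override_on k b A) = override_on (inf i k) b A"
    "sup (override_on i b A) (override_on k b A) = override_on (sup i k) b A" for i k
    by (auto simp: fun_eq_iff override_on_def)
  then show ?thesis using assms unfolding supermodular_def by metis
qed

text \<open>
  Writing \<open>\<phi>(I) = \<phi>(I with I\<^sub>j = 0) + I\<^sub>j * g(I)\<close>, where \<open>g\<close> is the increment of \<open>\<phi>\<close> in coordinate
  \<open>j\<close>, an independent copy of \<open>I\<^sub>j\<close> changes only the expectation of the last term, from \<open>E[I\<^sub>j g]\<close>
  to \<open>p * E[g]\<close>; and \<open>g\<close> is an increasing function of the other coordinates.
\<close>

lemma resample_coordinate:
  fixes f :: "('d::finite \<Rightarrow> bool) pmf"
  assumes na: "singleton_negatively_associated f" and p: "(\<Sum>i | i j. pmf f i) = p"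
    and "supermodular \<phi>"
  shows "measure_pmf.expectation f \<phi> \<le>
    p * measure_pmf.expectation f (\<lambda>i. \<phi> (i(j := True))) +
    (1 - p) * measure_pmf.expectation f (\<lambda>i. \<phi> (i(j := False)))"
proof -
  define g where "g i = \<phi> (i(j := True)) - \<phi> (i(j := False))" for i
  have mono: "\<forall>u v. (\<forall>l. l \<noteq> j \<longrightarrow> u l \<longrightarrow> v l) \<longrightarrow> g u \<le> g v"
    unfolding g_def using supermodular_increment_mono[OF \<open>supermodular \<phi>\<close>] by blast
  have "\<phi> i = \<phi> (i(j := False)) + of_bool (i j) * g i" for i
    by (cases "i j") (simp_all add: g_def fun_upd_idem)
  then have "measure_pmf.expectation f \<phi> =
      (\<Sum>i\<in>UNIV. pmf f i * \<phi> (i(j := False)) + of_bool (i j) * (pmf f i * g i))"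
    unfolding expectation_sum by (intro sum.cong refl) (metis distrib_left mult.left_commute)
  also have "\<dots> = (\<Sum>i\<in>UNIV. pmf f i * \<phi> (i(j := False))) + (\<Sum>i | i j. pmf f i * g i)"
    unfolding sum.distrib
    by (intro arg_cong2[where f = "(+)"] refl sum.mono_neutral_cong_right) auto
  also have "(\<Sum>i | i j. pmf f i * g i) \<le> p * (\<Sum>i\<in>UNIV. pmf f i * g i)"
    using na[unfolded singleton_negatively_associated_def, THEN spec[of _ j], THEN spec[of _ g], THEN mp]
      mono p by simp
  finally show ?thesis
    unfolding expectation_sum g_def
    by (simp add: fun_upd_def right_diff_distrib left_diff_distrib sum_subtractf)
qed

lemma expectation_Pi_pmf_insert_bernoulli:
  fixes G :: "('d::finite \<Rightarrow> bool) \<Rightarrow> real"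
  assumes "x \<notin> A" "p x \<in> {0..1}"
  shows "measure_pmf.expectation (Pi_pmf (insert x A) False (\<lambda>j. bernoulli_pmf (p j))) G =
    measure_pmf.expectation (Pi_pmf A False (\<lambda>j. bernoulli_pmf (p j)))
      (\<lambda>b. p x * G (b(x := True)) + (1 - p x) * G (b(x := False)))"
proof -
  let ?B = "bernoulli_pmf (p x)" and ?I = "Pi_pmf A False (\<lambda>j. bernoulli_pmf (p j))"
  have "measure_pmf.expectation (Pi_pmf (insert x A) False (\<lambda>j. bernoulli_pmf (p j))) G =
      measure_pmf.expectation (pair_pmf ?B ?I) (\<lambda>(c, b). G (b(x := c)))"
    using assms by (simp add: Pi_pmf_insert case_prod_unfold)
  also have "\<dots> = (\<Sum>(c, b)\<in>UNIV \<times> UNIV. pmf ?B c * pmf ?I b * G (b(x := c)))"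
    unfolding expectation_sum UNIV_Times_UNIV by (intro sum.cong) (auto simp: pmf_pair)
  also have "\<dots> = (\<Sum>c\<in>UNIV. \<Sum>b\<in>UNIV. pmf ?B c * pmf ?I b * G (b(x := c)))"
    by (rule sum.cartesian_product[symmetric])
  also have "\<dots> = (\<Sum>b\<in>UNIV. pmf ?I b * (p x * G (b(x := True)) + (1 - p x) * G (b(x := False))))"
    using assms by (simp add: UNIV_bool distrib_left sum.distrib mult_ac)
  finally show ?thesis by (simp only: expectation_sum)
qed

text \<open>
  The coordinates in a growing set \<open>A\<close> are replaced by independent ones. Conditionally on the
  coordinates \<open>b\<close> already drawn, the expectation is that of the supermodular function
  \<open>i \<mapsto> \<phi>(override_on i b A)\<close> under the original pmf \<open>f\<close>, so that the same one-coordinate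
  inequality applies at each step.
\<close>

lemma singleton_negatively_associated_NSD:
  fixes p :: "'d::finite \<Rightarrow> real"
  assumes p: "\<And>j. p j \<in> {0..1}" and f: "f \<in> bernoulli_class p"
    and na: "singleton_negatively_associated f"
  shows "NSD p f"
proof -
  let ?I = "\<lambda>A. Pi_pmf A False (\<lambda>j. bernoulli_pmf (p j))"
  let ?E = "measure_pmf.expectation"
  have marg: "(\<Sum>i | i j. pmf f i) = p j" for j
    using f by (simp add: bernoulli_class_iff[OF p])
  have "?E f \<phi> \<le> ?E (?I A) (\<lambda>b. ?E f (\<lambda>i. \<phi> (override_on i b A)))"
    if sm: "supermodular \<phi>" for \<phi> A
    using finite[of A]
  proof (induction A rule: finite_induct)
    case empty
    show ?case by simp
  next
    case (insert x A)
    let ?G = "\<lambda>b. ?E f (\<lambda>i. \<phi> (override_on i b (insert x A)))"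
    have "?E f (\<lambda>i. \<phi> (override_on i b A)) \<le>
        p x * ?G (b(x := True)) + (1 - p x) * ?G (b(x := False))" for b
    proof -
      have "override_on (i(x := c)) b A = override_on i (b(x := c)) (insert x A)" for i c
        using insert.hyps by (auto simp: fun_eq_iff override_on_def)
      then show ?thesis
        using resample_coordinate[OF na marg[of x] supermodular_override_on[OF sm, of b A]] by simp
    qed
    then have "?E (?I A) (\<lambda>b. ?E f (\<lambda>i. \<phi> (override_on i b A))) \<le>
        ?E (?I A) (\<lambda>b. p x * ?G (b(x := True)) + (1 - p x) * ?G (b(x := False)))"
      by (intro integral_mono) (auto intro: integrable_measure_pmf_finite)
    also have "\<dots> = ?E (?I (insert x A)) ?G"
      using expectation_Pi_pmf_insert_bernoulli[OF insert.hyps(2) p] by simp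
    finally show ?case using insert.IH by simp
  qed
  from this[of _ UNIV] have "?E f \<phi> \<le> ?E (?I UNIV) \<phi>" if "supermodular \<phi>" for \<phi>
    using that by (simp add: override_on_def)
  then show ?thesis
    by (simp add: NSD_def sm_order_def f indep_bernoulli_in_bernoulli_class
        flip: indep_bernoulli_def)
qed

lemma max_entropy_NSD:
  fixes p :: "'d::finite \<Rightarrow> real"
  assumes p: "\<And>j. p j \<in> {0..1}" and max: "max_entropy_pmf p f"
  shows "NSD p f"
proof -
  have f: "f \<in> bernoulli_class p" "sigma_countermonotonic f"
    using max by (auto simp: max_entropy_pmf_def is_arg_max_def sigma_countermonotonic_class_def)
  obtain k where k: "\<And>i. i \<in> set_pmf f \<Longrightarrow> card {l. i l} \<in> {k, Suc k}"
    using sigma_countermonotonic_two_layers[OF f(2)] by blast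
  have "singleton_negatively_associated f"
  proof (rule singleton_negatively_associated_two_layers[OF k])
    fix u v w z :: "'d \<Rightarrow> bool"
    assume "\<And>i. i \<in> {u, v, w, z} \<Longrightarrow> card {l. i l} \<in> {k, Suc k}"
      "inf u v = inf w z" "sup u v = sup w z"
    then show "pmf f u * pmf f v = pmf f w * pmf f z"
      by (intro order_antisym max_entropy_exchange_le[OF p max k, where u = u and v = v and w = w and z = z]
          max_entropy_exchange_le[OF p max k, where u = w and v = z and w = u and z = v]) auto
  qed
  with p f(1) show ?thesis by (rule singleton_negatively_associated_NSD)
qed

section \<open>Mixtures\<close>

lemma sm_order_mixture_mono:
  fixes p :: "'d::finite \<Rightarrow> real"
  assumes p: "\<And>j. p j \<in> {0..1}" and fg: "(f, g) \<in> sm_order p"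
    and "0 \<le> \<alpha>" "\<alpha> \<le> \<beta>" "\<beta> \<le> 1"
  shows "(mixture_pmf \<alpha> f g, mixture_pmf \<beta> f g) \<in> sm_order p"
proof -
  have E: "measure_pmf.expectation (mixture_pmf \<gamma> f g) \<phi> =
      (1 - \<gamma>) * measure_pmf.expectation f \<phi> + \<gamma> * measure_pmf.expectation g \<phi>"
    if "\<gamma> \<in> {0..1}" for \<gamma> \<phi>
    using that by (simp add: expectation_sum pmf_mixture_pmf sum_distrib_left sum.distrib algebra_simps
        sum_subtractf)
  have B: "mixture_pmf \<gamma> f g \<in> bernoulli_class p" if "\<gamma> \<in> {0..1}" for \<gamma>
  proof -
    have "(\<Sum>i | i j. pmf (mixture_pmf \<gamma> f g) i) =
        (1 - \<gamma>) * (\<Sum>i | i j. pmf f i) + \<gamma> * (\<Sum>i | i j. pmf g i)" for j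
      using that by (simp add: pmf_mixture_pmf sum.distrib sum_distrib_left)
    then show ?thesis
      using fg by (simp add: sm_order_def bernoulli_class_iff[OF p] algebra_simps)
  qed
  show ?thesis
    unfolding sm_order_def
  proof (intro CollectI case_prodI conjI allI impI B)
    fix \<phi> :: "('d \<Rightarrow> bool) \<Rightarrow> real" assume "supermodular \<phi>"
    then have "measure_pmf.expectation f \<phi> \<le> measure_pmf.expectation g \<phi>"
      using fg by (simp add: sm_order_def)
    then have "(\<beta> - \<alpha>) * measure_pmf.expectation f \<phi> \<le> (\<beta> - \<alpha>) * measure_pmf.expectation g \<phi>"
      using assms by (intro mult_left_mono) auto
    then show "measure_pmf.expectation (mixture_pmf \<alpha> f g) \<phi> \<le>
        measure_pmf.expectation (mixture_pmf \<beta> f g) \<phi>"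
      using assms by (simp add: E algebra_simps)
  qed (use assms in auto)
qed

lemma mixture_pmf_0 [simp]: "mixture_pmf 0 f g = f" and mixture_pmf_1 [simp]: "mixture_pmf 1 f g = g"
  by (rule pmf_eqI; simp add: pmf_mixture_pmf)+

theorem proposition5p2:
  fixes p :: "'d::finite \<Rightarrow> real" and fH :: "('d \<Rightarrow> bool) pmf"
  assumes "\<And>j. p j \<in> {0..1}"
    and "max_entropy_pmf p fH"
  shows "(\<lambda>\<alpha>. mixture_pmf \<alpha> fH (indep_bernoulli p)) ` {0..1} \<in> Chains (sm_order p)
    \<and> (\<forall>\<alpha>\<in>{0..1}. NSD p (mixture_pmf \<alpha> fH (indep_bernoulli p)))
    \<and> (\<forall>\<alpha>1 \<alpha>2. 0 \<le> \<alpha>1 \<and> \<alpha>1 \<le> \<alpha>2 \<and> \<alpha>2 \<le> 1 \<longrightarrow>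
         (fH, mixture_pmf \<alpha>1 fH (indep_bernoulli p)) \<in> sm_order p
       \<and> (mixture_pmf \<alpha>1 fH (indep_bernoulli p), mixture_pmf \<alpha>2 fH (indep_bernoulli p)) \<in> sm_order p
       \<and> (mixture_pmf \<alpha>2 fH (indep_bernoulli p), indep_bernoulli p) \<in> sm_order p)"
proof -
  let ?m = "\<lambda>\<alpha>. mixture_pmf \<alpha> fH (indep_bernoulli p)"
  have "(fH, indep_bernoulli p) \<in> sm_order p"
    using max_entropy_NSD[OF assms] by (simp add: NSD_def)
  then have mono: "(?m \<alpha>, ?m \<beta>) \<in> sm_order p" if "0 \<le> \<alpha>" "\<alpha> \<le> \<beta>" "\<beta> \<le> 1" for \<alpha> \<beta>
    using that by (intro sm_order_mixture_mono assms(1))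
  have "?m ` {0..1} \<in> Chains (sm_order p)"
    unfolding Chains_def
  proof (clarsimp)
    fix \<alpha> \<beta> :: real assume "0 \<le> \<alpha>" "\<alpha> \<le> 1" "0 \<le> \<beta>" "\<beta> \<le> 1"
      "(?m \<beta>, ?m \<alpha>) \<notin> sm_order p"
    then show "(?m \<alpha>, ?m \<beta>) \<in> sm_order p"
      by (cases "\<alpha> \<le> \<beta>") (use mono in auto)
  qed
  moreover have "NSD p (?m \<alpha>)" if "\<alpha> \<in> {0..1}" for \<alpha>
    using mono[of \<alpha> 1] that by (simp add: NSD_def)
  moreover have "(fH, ?m \<alpha>) \<in> sm_order p \<and> (?m \<alpha>, ?m \<beta>) \<in> sm_order p \<and>
      (?m \<beta>, indep_bernoulli p) \<in> sm_order p" if "0 \<le> \<alpha> \<and> \<alpha> \<le> \<beta> \<and> \<beta> \<le> 1" for \<alpha> \<beta>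
    using mono[of 0 \<alpha>] mono[of \<alpha> \<beta>] mono[of \<beta> 1] that by simp
  ultimately show ?thesis by blast
qed

end
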